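(* Let $A\in\mathbb{C}^{n\times n}$ be a matrix having all its eigenvalues in the open right half-plane, let $C\in\mathbb{C}^{n\times n}$ be any Hermitian positive definite matrix, and let $G\in\mathbb{C}^{n\times n}$ be the solution of the Lyapunov equation $A^*G+GA=C$. Then the numerical range $W_G(A)$ of $A$ in the $G$-inner product is contained in the open right half-plane, i.e., $\mathrm{Re}(z)>0$ for every $z\in W_G(A)$.
   Context: $A^*$ is the conjugate transpose. Since all eigenvalues of $A$ lie in the open right half-plane and $C$ is Hermitian positive definite, the equation $A^*G+GA=C$ has a unique solution $G$, and it is Hermitian positive definite (standard fact). The $G$-inner product is $\langle v,w\rangle_G:=w^*Gv$, and the numerical range of $A$ in the $G$-inner product is $$W_G(A):=\left\{\frac{\langle Av,v\rangle_G}{\langle v,v\rangle_G}:0\neq v\in\mathbb{C}^n\right\}=\left\{\frac{v^*GAv}{v^*Gv}:0\ne v\in\mathbb{C}^n\right\}.$$ *)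

theory Defs
  imports
    "Jordan_Normal_Form.Char_Poly"
    "Jordan_Normal_Form.Schur_Decomposition"
begin

definition hermitian_mat :: "complex mat \<Rightarrow> bool" where
  "hermitian_mat A \<longleftrightarrow> square_mat A \<and> mat_adjoint A = A"

text \<open>\<open>u \<bullet>c v\<close> conjugates its second argument, so \<open>(G *\<^sub>v v) \<bullet>c w\<close> is \<open>w\<^sup>* G v\<close>.\<close>

definition mat_inner :: "complex mat \<Rightarrow> complex vec \<Rightarrow> complex vec \<Rightarrow> complex" where
  "mat_inner G v w = (G *\<^sub>v v) \<bullet>c w"

text \<open>The real part in the next definition loses nothing: \<open>v\<^sup>* A v\<close> is real when \<open>A\<close> is Hermitian.\<close>

definition hermitian_pos_def :: "complex mat \<Rightarrow> bool" where
  "hermitian_pos_def A \<longleftrightarrow> hermitian_mat A \<and>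
     (\<forall>v \<in> carrier_vec (dim_row A). v \<noteq> 0\<^sub>v (dim_row A) \<longrightarrow> Re (mat_inner A v v) > 0)"

definition numerical_range :: "complex mat \<Rightarrow> complex mat \<Rightarrow> complex set" where
  "numerical_range G A =
     {mat_inner G (A *\<^sub>v v) v / mat_inner G v v | v.
        v \<in> carrier_vec (dim_row A) \<and> v \<noteq> 0\<^sub>v (dim_row A)}"

end

theory Submission
  imports Defs
begin

text \<open>
  Write \<open>g(x, y) = y\<^sup>* G x\<close>. Evaluated at \<open>x\<close>, Lyapunov's equation says
  \<open>g(A x, x) + g(x, A x) = x\<^sup>* C x > 0\<close>. Once \<open>g\<close> is Hermitian, the two summands are conjugate,
  so \<open>Re g(A x, x) = x\<^sup>* C x / 2 > 0\<close>; once \<open>g\<close> is also positive definite, dividing by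
  \<open>g(x, x)\<close> keeps the sign, which is the claim. So everything rests on \<open>G\<close> being Hermitian
  and positive definite. Both are obtained algebraically.

  \<^emph>\<open>Positivity\<close> (\<open>pos_triangular\<close>, \<open>pos_of_eigenvalues\<close>). Let \<open>g\<close> be a Hermitian form with
  \<open>Re g(A x, x) > 0\<close> for \<open>x \<noteq> 0\<close>. In a Schur basis \<open>A\<close> is triangular and preserves the flag
  of coordinate subspaces \<open>V\<^sub>0 \<subset> V\<^sub>1 \<subset> \<dots>\<close>. If \<open>g\<close> is positive definite on \<open>V\<^sub>k\<close>, choose
  \<open>q \<noteq> 0\<close> in \<open>V\<^bsub>k+1\<^esub>\<close> that is \<open>g\<close>-orthogonal to \<open>V\<^sub>k\<close>. Then \<open>A q \<in> \<lambda> q + V\<^sub>k\<close>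
  with \<open>\<lambda>\<close> an eigenvalue, hence \<open>Re g(A q, q) = Re \<lambda> g(q, q)\<close>, and \<open>Re \<lambda> > 0\<close> forces
  \<open>g(q, q) > 0\<close>. So \<open>g\<close> is positive definite on \<open>V\<^bsub>k+1\<^esub>\<close>.

  \<^emph>\<open>Symmetry\<close> (\<open>lyapunov_solution_symmetric\<close>). Split \<open>g\<close> into its Hermitian part and a
  skew part, the latter written as a multiple of a Hermitian form \<open>h\<close>. As \<open>x\<^sup>* C x\<close> is real,
  \<open>h\<close> does not contribute to the real part of the equation, so the positivity result applies to
  the Hermitian part plus \<open>t h\<close> for every real \<open>t\<close>. A whole line of positive definite forms
  must be constant, so \<open>h = 0\<close>.
\<close>

section \<open>Hermitian forms\<close>

locale hermitian_form =
  fixes n :: nat and g :: "complex vec \<Rightarrow> complex vec \<Rightarrow> complex"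
  assumes add_left: "\<lbrakk>x \<in> carrier_vec n; y \<in> carrier_vec n; z \<in> carrier_vec n\<rbrakk>
      \<Longrightarrow> g (x + y) z = g x z + g y z"
    and smult_left: "\<lbrakk>x \<in> carrier_vec n; y \<in> carrier_vec n\<rbrakk> \<Longrightarrow> g (c \<cdot>\<^sub>v x) y = c * g x y"
    and swap: "\<lbrakk>x \<in> carrier_vec n; y \<in> carrier_vec n\<rbrakk> \<Longrightarrow> g y x = cnj (g x y)"
begin

lemma add_right:
  assumes "x \<in> carrier_vec n" "y \<in> carrier_vec n" "z \<in> carrier_vec n"
  shows "g z (x + y) = g z x + g z y"
  using assms add_left[of x y z] swap[of "x + y" z] swap[of x z] swap[of y z] by simp

lemma smult_right:
  assumes "x \<in> carrier_vec n" "y \<in> carrier_vec n"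
  shows "g x (c \<cdot>\<^sub>v y) = cnj c * g x y"
  using assms smult_left[of y x c] swap[of "c \<cdot>\<^sub>v y" x] swap[of y x] by simp

lemma diff_left:
  assumes "x \<in> carrier_vec n" "y \<in> carrier_vec n" "z \<in> carrier_vec n"
  shows "g (x - y) z = g x z - g y z"
proof -
  have "x - y = x + (-1) \<cdot>\<^sub>v y" using assms by auto
  then show ?thesis using assms add_left[of x "(-1) \<cdot>\<^sub>v y" z] smult_left[of y z "-1"] by simp
qed

lemma Im_diag:
  assumes "x \<in> carrier_vec n" shows "Im (g x x) = 0"
  using swap[OF assms assms] by (metis cnj.sel(2) neg_equal_zero)

lemma zero_left:
  assumes "y \<in> carrier_vec n" shows "g (0\<^sub>v n) y = 0"
proof -
  have "(0::complex) \<cdot>\<^sub>v 0\<^sub>v n = 0\<^sub>v n" by auto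
  then show ?thesis using smult_left[of "0\<^sub>v n" y 0] assms by simp
qed

text \<open>Polarization: expanding \<open>g (u + y) (u + y)\<close> gives the real part of \<open>g u y\<close>,
  and \<open>u = \<i> x\<close> turns this into the imaginary part.\<close>

lemma zero_if_diag_zero:
  assumes diag: "\<And>x. x \<in> carrier_vec n \<Longrightarrow> g x x = 0"
    and x: "x \<in> carrier_vec n" and y: "y \<in> carrier_vec n"
  shows "g x y = 0"
proof -
  have re: "Re (g u y) = 0" if u: "u \<in> carrier_vec n" for u
  proof -
    have "0 = g (u + y) (u + y)" using diag[of "u + y"] u y by simp
    also have "\<dots> = g u y + g y u"
      using u y diag[OF u] diag[OF y] by (simp add: add_left add_right)
    finally show ?thesis using swap[OF u y] by (simp add: complex_eq_iff)
  qed
  have "Re (\<i> * g x y) = 0" using re[of "\<i> \<cdot>\<^sub>v x"] x y by (simp add: smult_left)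
  then show ?thesis using re[OF x] by (simp add: complex_eq_iff)
qed

text \<open>Induction along the coordinate flag \<open>V k\<close> that \<open>B\<close> preserves. Positivity on \<open>V k\<close> is
  carried together with the existence of \<open>g\<close>-orthogonal projections onto \<open>V k\<close>. The second
  property produces the new direction \<open>q\<close> and extends itself by one Gram-Schmidt step, so no
  orthogonal basis has to be named.\<close>

lemma pos_triangular:
  assumes B: "B \<in> carrier_mat n n" and tri: "upper_triangular B"
    and diag: "\<And>i. i < n \<Longrightarrow> Re (B $$ (i, i)) > 0"
    and diss: "\<And>x. \<lbrakk>x \<in> carrier_vec n; x \<noteq> 0\<^sub>v n\<rbrakk> \<Longrightarrow> Re (g (B *\<^sub>v x) x) > 0"
    and x: "x \<in> carrier_vec n" and x0: "x \<noteq> 0\<^sub>v n"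
  shows "Re (g x x) > 0"
proof -
  define V :: "nat \<Rightarrow> complex vec set"
    where "V k = {x \<in> carrier_vec n. \<forall>i<n. k \<le> i \<longrightarrow> x $ i = 0}" for k
  have Vc: "z \<in> carrier_vec n" if "z \<in> V k" for z k using that by (simp add: V_def)
  have "(\<forall>x \<in> V k. x \<noteq> 0\<^sub>v n \<longrightarrow> Re (g x x) > 0) \<and>
        (\<forall>w \<in> carrier_vec n. \<exists>y \<in> V k. \<forall>z \<in> V k. g (w - y) z = 0)" if "k \<le> n" for k
    using that
  proof (induction k)
    case 0
    have V0: "V 0 = {0\<^sub>v n}" by (auto simp: V_def)
    show ?case unfolding V0 using swap[OF zero_carrier_vec] by (auto simp: zero_left)
  next
    case (Suc k)
    then have k: "k < n" by simp
    have pos: "Re (g x x) > 0" if "x \<in> V k" "x \<noteq> 0\<^sub>v n" for x using Suc that by simp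
    have proj: "\<exists>y \<in> V k. \<forall>z \<in> V k. g (w - y) z = 0" if "w \<in> carrier_vec n" for w
      using Suc that by simp
    obtain y where y: "y \<in> V k" and orth: "\<And>z. z \<in> V k \<Longrightarrow> g (unit_vec n k - y) z = 0"
      using proj[of "unit_vec n k"] by auto
    define q where "q = unit_vec n k - y"
    have q: "q \<in> carrier_vec n" using Vc[OF y] by (simp add: q_def)
    have qk: "q $ k = 1" and qi: "\<And>i. \<lbrakk>k < i; i < n\<rbrakk> \<Longrightarrow> q $ i = 0"
      using y k by (auto simp: q_def V_def)
    have qV: "g q z = 0" if "z \<in> V k" for z using orth[OF that] by (simp add: q_def)
    have Vq: "g z q = 0" if "z \<in> V k" for z using qV[OF that] swap[OF q Vc[OF that]] by simp
    let ?l = "B $$ (k, k)"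
    \<comment> \<open>Modulo \<open>V k\<close>, which is orthogonal to \<open>q\<close>, the matrix \<open>B\<close> acts on \<open>q\<close> as the
      scalar \<open>?l\<close>; this is where triangularity enters.\<close>
    have "(B *\<^sub>v q - ?l \<cdot>\<^sub>v q) $ i = 0" if i: "i < n" "k \<le> i" for i
    proof -
      have "(B *\<^sub>v q) $ i = (\<Sum>j = 0..<n. B $$ (i, j) * q $ j)"
        using B q i by (simp add: scalar_prod_def)
      also have "\<dots> = (\<Sum>j \<in> {0..<n}. if j = k then B $$ (i, k) else 0)"
      proof (rule sum.cong)
        fix j assume j: "j \<in> {0..<n}"
        consider "j < k" | "j = k" | "k < j" by linarith
        then show "B $$ (i, j) * q $ j = (if j = k then B $$ (i, k) else 0)"
        proof cases
          case 1
          then have "B $$ (i, j) = 0" using upper_triangularD[OF tri, of j i] B i by auto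
          then show ?thesis using 1 by simp
        qed (use qk qi j in auto)
      qed simp
      also have "\<dots> = B $$ (i, k)" using k by simp
      finally have Bq: "(B *\<^sub>v q) $ i = B $$ (i, k)" .
      show ?thesis
      proof (cases "i = k")
        case True
        then show ?thesis using Bq B q i qk by simp
      next
        case False
        then have "B $$ (i, k) = 0" using upper_triangularD[OF tri, of k i] B i by auto
        then show ?thesis using Bq B q i qi[of i] False by simp
      qed
    qed
    then have "B *\<^sub>v q - ?l \<cdot>\<^sub>v q \<in> V k" using B q by (auto simp: V_def)
    then have "g (B *\<^sub>v q - ?l \<cdot>\<^sub>v q) q = 0" by (rule Vq)
    then have "g (B *\<^sub>v q) q = ?l * g q q" using B q by (simp add: diff_left smult_left)
    moreover have "q \<noteq> 0\<^sub>v n" using qk k by auto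
    ultimately have "Re ?l * Re (g q q) > 0" using diss[OF q] Im_diag[OF q] by simp
    then have gq: "Re (g q q) > 0" using diag[OF k] by (simp add: zero_less_mult_iff)
    have split: "\<exists>u \<in> V k. z = u + z $ k \<cdot>\<^sub>v q" if z: "z \<in> V (Suc k)" for z
    proof (rule bexI)
      show "z - z $ k \<cdot>\<^sub>v q \<in> V k"
        using z q k qk qi
        by (auto simp: V_def)
          (metis Suc_leI le_neq_implies_less mult_zero_right diff_zero diff_self
            mult.right_neutral)
      show "z = z - z $ k \<cdot>\<^sub>v q + z $ k \<cdot>\<^sub>v q" using Vc[OF z] q by auto
    qed
    have "Re (g x x) > 0" if x: "x \<in> V (Suc k)" and x0: "x \<noteq> 0\<^sub>v n" for x
    proof -
      obtain u where u: "u \<in> V k" and xu: "x = u + x $ k \<cdot>\<^sub>v q" using split[OF x] by blast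
      define c where "c = x $ k"
      have xc: "x = u + c \<cdot>\<^sub>v q" using xu by (simp add: c_def)
      have "g x x = g u u + c * (cnj c * g q q)"
        unfolding xc using Vc[OF u] q qV[OF u] Vq[OF u]
        by (simp add: add_left add_right smult_left smult_right)
      also have "c * (cnj c * g q q) = of_real ((cmod c)\<^sup>2) * g q q"
        by (simp add: complex_norm_square mult.assoc del: of_real_power)
      finally have eq: "Re (g x x) = Re (g u u) + (cmod c)\<^sup>2 * Re (g q q)" by simp
      show ?thesis
      proof (cases "u = 0\<^sub>v n")
        case True
        then have "c \<noteq> 0" using xc x0 q by auto
        then show ?thesis using eq gq True zero_left[of u] by simp
      next
        case False
        then show ?thesis using eq gq pos[OF u False] by (simp add: add_pos_nonneg)
      qed
    qed
    moreover have "\<exists>y \<in> V (Suc k). \<forall>z \<in> V (Suc k). g (w - y) z = 0"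
      if w: "w \<in> carrier_vec n" for w
    proof -
      obtain v where v: "v \<in> V k" and orth: "\<And>z. z \<in> V k \<Longrightarrow> g (w - v) z = 0"
        using proj[OF w] by blast
      define t where "t = g w q / g q q"
      have "v + t \<cdot>\<^sub>v q \<in> V (Suc k)" using v q qi by (auto simp: V_def)
      moreover have "g (w - (v + t \<cdot>\<^sub>v q)) z = 0" if z: "z \<in> V (Suc k)" for z
      proof -
        obtain u where u: "u \<in> V k" and zu: "z = u + z $ k \<cdot>\<^sub>v q" using split[OF z] by blast
        have dec: "g (w - (v + t \<cdot>\<^sub>v q)) z' = g (w - v) z' - t * g q z'"
          if "z' \<in> carrier_vec n" for z'
          using w Vc[OF v] q that by (simp add: diff_left add_left smult_left)
        have "g (w - v) q = g w q" using w Vc[OF v] q Vq[OF v] by (simp add: diff_left)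
        moreover have "g q q \<noteq> 0" using gq by auto
        ultimately have "g (w - (v + t \<cdot>\<^sub>v q)) q = 0" unfolding dec[OF q] by (simp add: t_def)
        moreover have "g (w - (v + t \<cdot>\<^sub>v q)) u = 0"
          by (simp add: dec[OF Vc[OF u]] orth[OF u] qV[OF u])
        ultimately show ?thesis
          using w Vc[OF v] Vc[OF u] q by (subst zu) (simp add: add_right smult_right)
      qed
      ultimately show ?thesis by blast
    qed
    ultimately show ?case by blast
  qed
  from this[of n] show ?thesis using x x0 by (simp add: V_def)
qed

text \<open>One direction of Lyapunov's stability theorem. The hypotheses and the conclusion are
  invariant under a change of basis, because \<open>g\<close> is transported by the same invertible \<open>P\<close>
  that brings \<open>A\<close> into triangular form.\<close>

lemma pos_of_eigenvalues:
  assumes A: "A \<in> carrier_mat n n"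
    and ev: "\<And>k. eigenvalue A k \<Longrightarrow> Re k > 0"
    and diss: "\<And>x. \<lbrakk>x \<in> carrier_vec n; x \<noteq> 0\<^sub>v n\<rbrakk> \<Longrightarrow> Re (g (A *\<^sub>v x) x) > 0"
    and x: "x \<in> carrier_vec n" and x0: "x \<noteq> 0\<^sub>v n"
  shows "Re (g x x) > 0"
proof -
  obtain es where es: "char_poly A = (\<Prod>e\<leftarrow>es. [:- e, 1:])"
    using char_poly_factorized[OF A] by blast
  obtain B P Q where "schur_decomposition A es = (B, P, Q)"
    by (cases "schur_decomposition A es") auto
  from schur_decomposition[OF A es this]
  have wit: "similar_mat_wit A B P Q" and tri: "upper_triangular B" and dB: "diag_mat B = es"
    by auto
  note W = similar_mat_witD2[OF A wit]
  have B: "B \<in> carrier_mat n n" and P: "P \<in> carrier_mat n n" and Q: "Q \<in> carrier_mat n n"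
    and PQ: "P * Q = 1\<^sub>m n" and QP: "Q * P = 1\<^sub>m n" and APBQ: "A = P * B * Q"
    using W by auto
  have "A * P = P * B * (Q * P)" unfolding APBQ
    using assoc_mult_mat[OF mult_carrier_mat[OF P B] Q P] .
  then have AP: "A * P = P * B" using B P QP by simp
  interpret P: hermitian_form n "\<lambda>x y. g (P *\<^sub>v x) (P *\<^sub>v y)"
    using P by unfold_locales
      (auto simp: mult_add_distrib_mat_vec mult_mat_vec add_left smult_left intro: swap)
  have PQx: "P *\<^sub>v (Q *\<^sub>v x) = x"
    using x P Q PQ by (metis assoc_mult_mat_vec one_mult_mat_vec)
  have "Re (g (P *\<^sub>v (Q *\<^sub>v x)) (P *\<^sub>v (Q *\<^sub>v x))) > 0"
  proof (rule P.pos_triangular[OF B tri])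
    fix i assume "i < n"
    then have "B $$ (i, i) \<in> set es" using B by (auto simp: dB[symmetric] diag_mat_def)
    then have "poly (char_poly A) (B $$ (i, i)) = 0"
      by (auto simp: es poly_prod_list o_def prod_list_zero_iff)
    then show "Re (B $$ (i, i)) > 0" using ev eigenvalue_root_char_poly[OF A] by blast
  next
    fix y :: "complex vec" assume y: "y \<in> carrier_vec n" "y \<noteq> 0\<^sub>v n"
    have "Q *\<^sub>v (P *\<^sub>v y) = y" using y P Q QP by (metis assoc_mult_mat_vec one_mult_mat_vec)
    moreover have "Q *\<^sub>v 0\<^sub>v n = 0\<^sub>v n" using Q by auto
    ultimately have "P *\<^sub>v y \<noteq> 0\<^sub>v n" using y by metis
    moreover have "P *\<^sub>v (B *\<^sub>v y) = A *\<^sub>v (P *\<^sub>v y)"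
      using y A B P AP by (metis assoc_mult_mat_vec)
    ultimately show "Re (g (P *\<^sub>v (B *\<^sub>v y)) (P *\<^sub>v y)) > 0"
      using diss[of "P *\<^sub>v y"] y P by simp
  next
    show "Q *\<^sub>v x \<in> carrier_vec n" using Q x by simp
    have "P *\<^sub>v 0\<^sub>v n = 0\<^sub>v n" using P by auto
    then show "Q *\<^sub>v x \<noteq> 0\<^sub>v n" using PQx x0 by metis
  qed
  then show ?thesis by (simp add: PQx)
qed

end

section \<open>Lyapunov's equation\<close>

lemma mat_adjoint_carrier:
  assumes "A \<in> carrier_mat n m" shows "mat_adjoint A \<in> carrier_mat m n"
  using assms by (auto simp: mat_adjoint_def)

lemma mat_adjoint_cscalar_prod:
  fixes A :: "complex mat"
  assumes A: "A \<in> carrier_mat n m" and v: "v \<in> carrier_vec n" and w: "w \<in> carrier_vec m"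
  shows "(mat_adjoint A *\<^sub>v v) \<bullet>c w = v \<bullet>c (A *\<^sub>v w)"
proof -
  have "(mat_adjoint A *\<^sub>v v) \<bullet>c w = (\<Sum>i<m. (\<Sum>j<n. cnj (A $$ (j, i)) * v $ j) * cnj (w $ i))"
    using A v w by (simp add: scalar_prod_def mat_adjoint_def mat_of_rows_def atLeast0LessThan)
  also have "\<dots> = (\<Sum>j<n. \<Sum>i<m. cnj (A $$ (j, i)) * v $ j * cnj (w $ i))"
    by (subst sum.swap) (simp add: sum_distrib_right)
  also have "\<dots> = v \<bullet>c (A *\<^sub>v w)"
    using A v w by (simp add: scalar_prod_def atLeast0LessThan sum_distrib_left ac_simps)
  finally show ?thesis .
qed

text \<open>Positivity does the work of the usual uniqueness argument for the Lyapunov equation.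
  With \<open>s\<close> twice the Hermitian part of \<open>g\<close> and \<open>h\<close> proportional to the skew part, the real
  part of \<open>(s + t h)(A x, x)\<close> is \<open>Re (g(A x, x) + g(x, A x))\<close> for every real \<open>t\<close>, so all
  forms \<open>s + t h\<close> are positive definite; an affine function of \<open>t\<close> that stays positive has
  slope \<open>0\<close>.\<close>

lemma lyapunov_solution_symmetric:
  fixes g :: "complex vec \<Rightarrow> complex vec \<Rightarrow> complex"
  assumes A: "A \<in> carrier_mat n n"
    and ev: "\<And>k. eigenvalue A k \<Longrightarrow> Re k > 0"
    and addl: "\<And>x y z. \<lbrakk>x \<in> carrier_vec n; y \<in> carrier_vec n; z \<in> carrier_vec n\<rbrakk>
      \<Longrightarrow> g (x + y) z = g x z + g y z"
    and addr: "\<And>x y z. \<lbrakk>x \<in> carrier_vec n; y \<in> carrier_vec n; z \<in> carrier_vec n\<rbrakk>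
      \<Longrightarrow> g z (x + y) = g z x + g z y"
    and smultl: "\<And>x y c. \<lbrakk>x \<in> carrier_vec n; y \<in> carrier_vec n\<rbrakk> \<Longrightarrow> g (c \<cdot>\<^sub>v x) y = c * g x y"
    and smultr: "\<And>x y c. \<lbrakk>x \<in> carrier_vec n; y \<in> carrier_vec n\<rbrakk> \<Longrightarrow> g x (c \<cdot>\<^sub>v y) = cnj c * g x y"
    and pos: "\<And>x. \<lbrakk>x \<in> carrier_vec n; x \<noteq> 0\<^sub>v n\<rbrakk> \<Longrightarrow> Re (g (A *\<^sub>v x) x + g x (A *\<^sub>v x)) > 0"
    and real: "\<And>x. x \<in> carrier_vec n \<Longrightarrow> Im (g (A *\<^sub>v x) x + g x (A *\<^sub>v x)) = 0"
    and x: "x \<in> carrier_vec n" and y: "y \<in> carrier_vec n"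
  shows "g y x = cnj (g x y)"
proof -
  define s where "s x y = g x y + cnj (g y x)" for x y
  define h where "h x y = \<i> * (g x y - cnj (g y x))" for x y
  interpret h: hermitian_form n h
    by unfold_locales (simp_all add: h_def addl addr smultl smultr algebra_simps)
  have line: "Re (s u u) + t * Re (h u u) > 0"
    if u: "u \<in> carrier_vec n" "u \<noteq> 0\<^sub>v n" for u and t :: real
  proof -
    interpret t: hermitian_form n "\<lambda>x y. s x y + of_real t * h x y"
      by unfold_locales (simp_all add: s_def h_def addl addr smultl smultr algebra_simps)
    have "Re (s (A *\<^sub>v v) v + of_real t * h (A *\<^sub>v v) v) > 0"
      if v: "v \<in> carrier_vec n" "v \<noteq> 0\<^sub>v n" for v
    proof -
      have "Re (s (A *\<^sub>v v) v + of_real t * h (A *\<^sub>v v) v) =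
            Re (g (A *\<^sub>v v) v + g v (A *\<^sub>v v)) - t * Im (g (A *\<^sub>v v) v + g v (A *\<^sub>v v))"
        by (simp add: s_def h_def algebra_simps)
      then show ?thesis using pos[OF v] real[OF v(1)] by simp
    qed
    from t.pos_of_eigenvalues[OF A ev this u] show ?thesis by simp
  qed
  have diag: "h u u = 0" if u: "u \<in> carrier_vec n" for u
  proof (cases "u = 0\<^sub>v n")
    case True
    then show ?thesis using h.zero_left u by simp
  next
    case False
    have "Re (h u u) = 0"
    proof (rule ccontr)
      assume "Re (h u u) \<noteq> 0"
      then show False using line[OF u False, of "- Re (s u u) / Re (h u u)"] by simp
    qed
    then show ?thesis using h.Im_diag[OF u] by (simp add: complex_eq_iff)
  qed
  have "h x y = 0" using h.zero_if_diag_zero[OF diag x y] .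
  then have "g x y = cnj (g y x)" by (simp add: h_def)
  then show ?thesis by simp
qed

theorem mainTheorem5:
  fixes n :: nat and A C G :: "complex mat"
  assumes "A \<in> carrier_mat n n"
    and "C \<in> carrier_mat n n"
    and "G \<in> carrier_mat n n"
    and "\<And>k. eigenvalue A k \<Longrightarrow> Re k > 0"
    and "hermitian_pos_def C"
    and "mat_adjoint A * G + G * A = C"
  shows "\<forall>z \<in> numerical_range G A. Re z > 0"
proof -
  note A = assms(1) and C = assms(2) and G = assms(3) and ev = assms(4)
  let ?g = "mat_inner G"
  have addl: "?g (x + y) z = ?g x z + ?g y z"
    if "x \<in> carrier_vec n" "y \<in> carrier_vec n" "z \<in> carrier_vec n" for x y z
    using that G by (simp add: mat_inner_def mult_add_distrib_mat_vec add_scalar_prod_distrib[of _ n])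
  have addr: "?g z (x + y) = ?g z x + ?g z y"
    if "x \<in> carrier_vec n" "y \<in> carrier_vec n" "z \<in> carrier_vec n" for x y z
    using that G by (simp add: mat_inner_def conjugate_add_vec[of _ n] scalar_prod_add_distrib[of _ n])
  have smultl: "?g (c \<cdot>\<^sub>v x) y = c * ?g x y"
    if "x \<in> carrier_vec n" "y \<in> carrier_vec n" for x y c
    using that G by (simp add: mat_inner_def mult_mat_vec)
  have smultr: "?g x (c \<cdot>\<^sub>v y) = cnj c * ?g x y"
    if "x \<in> carrier_vec n" "y \<in> carrier_vec n" for x y c
    using that G by (simp add: mat_inner_def conjugate_smult_vec)
  have lyap: "?g (A *\<^sub>v x) x + ?g x (A *\<^sub>v x) = mat_inner C x x" if x: "x \<in> carrier_vec n" for x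
  proof -
    note A' = mat_adjoint_carrier[OF A]
    have "C *\<^sub>v x = mat_adjoint A *\<^sub>v (G *\<^sub>v x) + G *\<^sub>v (A *\<^sub>v x)"
      unfolding assms(6)[symmetric] using x A A' G
      by (simp add: add_mult_distrib_mat_vec[of _ n n] assoc_mult_mat_vec[of _ n n])
    then have "mat_inner C x x = (mat_adjoint A *\<^sub>v (G *\<^sub>v x)) \<bullet>c x + (G *\<^sub>v (A *\<^sub>v x)) \<bullet>c x"
      using x A A' G by (simp add: mat_inner_def add_scalar_prod_distrib[of _ n])
    also have "(mat_adjoint A *\<^sub>v (G *\<^sub>v x)) \<bullet>c x = (G *\<^sub>v x) \<bullet>c (A *\<^sub>v x)"
      using x A G by (simp add: mat_adjoint_cscalar_prod)
    finally show ?thesis by (simp add: mat_inner_def)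
  qed
  have Cpos: "Re (mat_inner C x x) > 0" if "x \<in> carrier_vec n" "x \<noteq> 0\<^sub>v n" for x
    using assms(5) that C by (simp add: hermitian_pos_def_def)
  have Creal: "Im (mat_inner C x x) = 0" if x: "x \<in> carrier_vec n" for x
  proof -
    have "mat_adjoint C = C" using assms(5) by (simp add: hermitian_pos_def_def hermitian_mat_def)
    then have "(C *\<^sub>v x) \<bullet>c x = x \<bullet>c (C *\<^sub>v x)" using mat_adjoint_cscalar_prod[OF C x x] by simp
    also have "\<dots> = cnj ((C *\<^sub>v x) \<bullet>c x)"
      using x C by (simp add: scalar_prod_def ac_simps)
    finally show ?thesis by (simp add: mat_inner_def complex_eq_iff)
  qed
  have sym: "?g y x = cnj (?g x y)" if "x \<in> carrier_vec n" "y \<in> carrier_vec n" for x y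
    using lyapunov_solution_symmetric[OF A ev addl addr smultl smultr _ _ that]
    by (simp add: lyap Cpos Creal)
  interpret G: hermitian_form n ?g
    by unfold_locales (auto simp: addl smultl intro: sym)
  have half: "Re (?g (A *\<^sub>v x) x) > 0" if x: "x \<in> carrier_vec n" "x \<noteq> 0\<^sub>v n" for x
  proof -
    have "?g x (A *\<^sub>v x) = cnj (?g (A *\<^sub>v x) x)" using sym[of "A *\<^sub>v x" x] x A by simp
    then have "Re (mat_inner C x x) = 2 * Re (?g (A *\<^sub>v x) x)" by (simp flip: lyap[OF x(1)])
    then show ?thesis using Cpos[OF x] by simp
  qed
  show ?thesis
  proof
    fix z assume "z \<in> numerical_range G A"
    then obtain v where v: "v \<in> carrier_vec n" "v \<noteq> 0\<^sub>v n"
      and z: "z = ?g (A *\<^sub>v v) v / ?g v v" using A by (auto simp: numerical_range_def)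
    have "?g v v = of_real (Re (?g v v))" using G.Im_diag[OF v(1)] by (simp add: complex_eq_iff)
    then have "Re z = Re (?g (A *\<^sub>v v) v) / Re (?g v v)" unfolding z by (metis Re_divide_of_real)
    moreover have "Re (?g v v) > 0" using G.pos_of_eigenvalues[OF A ev half v] .
    ultimately show "Re z > 0" using half[OF v] by simp
  qed
qed

end
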